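(* Let $x_1,x_2,x_3,x_4$ be four distinct points in a plane of $\mathbb R^3$ which are the consecutive vertices of a cyclic quadrilateral (i.e. they lie, in this cyclic order, on a circle). Then $$|D_4|^2\ \ge\ \prod_{\{i<j<k\}\subset\{1,2,3,4\}}\bigl(d_3(r_{ij},r_{ik},r_{jk})+8r_{ij}r_{ik}r_{jk}\bigr)$$ (Atiyah–Sutcliffe Conjecture C3), and also $|D_4|\ge 64\prod_{1\le i<j\le4}r_{ij}$ (Conjecture C2).
   Context: Put $d_3(a,b,c)=(a+b-c)(b+c-a)(c+a-b)$. For distinct points $x_1,\dots,x_4\in\mathbb R^3$ let $r_{ij}=|x_i-x_j|$, and let $V$ be the volume of the tetrahedron with these vertices ($V=0$ if coplanar). The (non-normalized) Atiyah determinant $D_4\in\mathbb C$ is defined as follows. Identify $S^2$ with $\mathbb{CP}^1=\mathbb C\cup\{\infty\}$ by stereographic projection, so that the antipode of $t$ is $-1/\bar t$. For $i\ne j$ let $t_{ij}$ be the point corresponding to the unit vector $(x_j-x_i)/r_{ij}$. For each pair $i<j$ choose a unit vector $(\alpha,\beta)\in\mathbb C^2$ such that $\ell_{ij}(t)=\alpha t+\beta$ has root $t_{ij}$ (with $\alpha=0$ if $t_{ij}=\infty$), and put $\ell_{ji}(t)=-\bar\beta t+\bar\alpha$ (which has root $t_{ji}$). Let $p_i(t)=\prod_{j\ne i}\ell_{ij}(t)=\sum_{j=1}^4 m_{ij}t^{j-1}$ and $D_4=64\prod_{1\le i<j\le4}r_{ij}\cdot\det(m_{ij})$; this does not depend on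 the choices. Known fact (Eastwood–Norbury): $$\Re(D_4)=64\prod_{i<j}r_{ij}-4d_3(r_{12}r_{34},r_{13}r_{24},r_{14}r_{23})+A_4+288V^2,$$ $$A_4=\sum_{l=1}^4\Bigl(\sum_{i\ne l}r_{li}\bigl((r_{lj}+r_{lk})^2-r_{jk}^2\bigr)\Bigr)d_3(r_{ij},r_{ik},r_{jk}),\qquad \{j,k\}=\{1,2,3,4\}\setminus\{l,i\},$$ and $D_4$ is real when the four points are coplanar. *)

theory Defs
  imports "HOL-Analysis.Analysis" "Jordan_Normal_Form.Determinant"
begin

hide_const (open) Determinants.det

definition d3 :: "real \<Rightarrow> real \<Rightarrow> real \<Rightarrow> real" where
  "d3 a b c = (a + b - c) * (b + c - a) * (c + a - b)"

definition rdist :: "(nat \<Rightarrow> real^3) \<Rightarrow> nat \<Rightarrow> nat \<Rightarrow> real" where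
  "rdist x i j = dist (x i) (x j)"

(* Stereographic projection of the unit sphere from the north pole (0,0,1); None stands for the
   point at infinity. *)
definition stereo :: "real^3 \<Rightarrow> complex option" where
  "stereo u = (if vec_nth u 3 = 1 then None
               else Some (Complex (vec_nth u 1) (vec_nth u 2) / of_real (1 - vec_nth u 3)))"

(* The linear form a t + b has the given point of the Riemann sphere as its root. *)
definition linear_root :: "complex \<Rightarrow> complex \<Rightarrow> complex option \<Rightarrow> bool" where
  "linear_root a b z = (case z of None \<Rightarrow> a = 0 | Some t \<Rightarrow> a * t + b = 0)"

definition direction :: "(nat \<Rightarrow> real^3) \<Rightarrow> nat \<Rightarrow> nat \<Rightarrow> real^3" where
  "direction x i j = (x j - x i) /\<^sub>R rdist x i j"

definition atiyah_lifts ::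
    "(nat \<Rightarrow> real^3) \<Rightarrow> (nat \<Rightarrow> nat \<Rightarrow> complex) \<Rightarrow> (nat \<Rightarrow> nat \<Rightarrow> complex) \<Rightarrow> bool" where
  "atiyah_lifts x \<alpha> \<beta> \<longleftrightarrow>
     (\<forall>i\<in>{1..4}. \<forall>j\<in>{1..4}. i < j \<longrightarrow>
        (cmod (\<alpha> i j))\<^sup>2 + (cmod (\<beta> i j))\<^sup>2 = 1 \<and>
        linear_root (\<alpha> i j) (\<beta> i j) (stereo (direction x i j)))"

definition atiyah_ell ::
    "(nat \<Rightarrow> nat \<Rightarrow> complex) \<Rightarrow> (nat \<Rightarrow> nat \<Rightarrow> complex) \<Rightarrow> nat \<Rightarrow> nat \<Rightarrow> complex poly" where
  "atiyah_ell \<alpha> \<beta> i j =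
     (if i < j then [:\<beta> i j, \<alpha> i j:] else [:cnj (\<alpha> j i), - cnj (\<beta> j i):])"

definition atiyah_poly ::
    "(nat \<Rightarrow> nat \<Rightarrow> complex) \<Rightarrow> (nat \<Rightarrow> nat \<Rightarrow> complex) \<Rightarrow> nat \<Rightarrow> complex poly" where
  "atiyah_poly \<alpha> \<beta> i = (\<Prod>j\<in>{1..4} - {i}. atiyah_ell \<alpha> \<beta> i j)"

(* Points are indexed by 1..4, while rows and columns of mat 4 4 are indexed from 0. *)
definition atiyah_D4 ::
    "(nat \<Rightarrow> real^3) \<Rightarrow> (nat \<Rightarrow> nat \<Rightarrow> complex) \<Rightarrow> (nat \<Rightarrow> nat \<Rightarrow> complex) \<Rightarrow> complex" where
  "atiyah_D4 x \<alpha> \<beta> =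
     64 * of_real (\<Prod>i\<in>{1..4}. \<Prod>j\<in>{i<..4}. rdist x i j) *
       Determinant.det (mat 4 4 (\<lambda>(i, j). coeff (atiyah_poly \<alpha> \<beta> (i + 1)) j))"

(* x 1, x 2, x 3, x 4 lie in this cyclic order on a circle of the plane through c spanned by u, v.
   Both directions of traversal are covered, since v may be replaced by -v. *)
definition cyclic_quadrilateral :: "(nat \<Rightarrow> real^3) \<Rightarrow> bool" where
  "cyclic_quadrilateral x \<longleftrightarrow>
     (\<exists>c u v R \<theta>. norm u = 1 \<and> norm v = 1 \<and> u \<bullet> v = 0 \<and> R > 0 \<and>
        \<theta> 1 < \<theta> 2 \<and> \<theta> 2 < \<theta> 3 \<and> \<theta> 3 < \<theta> 4 \<and> \<theta> 4 < \<theta> 1 + 2 * pi \<and>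
        (\<forall>i\<in>{1..4}. x i = c + R *\<^sub>R (cos (\<theta> i) *\<^sub>R u + sin (\<theta> i) *\<^sub>R v)))"

lemma unit_linear_root_exists:
  "\<exists>a b. (cmod a)\<^sup>2 + (cmod b)\<^sup>2 = 1 \<and> linear_root a b z"
proof (cases z)
  case None
  then show ?thesis by (intro exI[of _ 0] exI[of _ 1]) (simp add: linear_root_def)
next
  case (Some t)
  define s where "s = sqrt (1 + (cmod t)\<^sup>2)"
  have s: "s \<noteq> 0" "s\<^sup>2 = 1 + (cmod t)\<^sup>2"
    unfolding s_def by (auto simp: add_nonneg_eq_0_iff)
  have "(cmod (1 / of_real s))\<^sup>2 + (cmod (- t / of_real s))\<^sup>2 = (1 + (cmod t)\<^sup>2) / s\<^sup>2"
    by (simp add: norm_divide power_divide add_divide_distrib)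
  also have "\<dots> = 1" using s by (metis divide_self power_not_zero)
  finally show ?thesis using Some
    by (intro exI[of _ "1 / of_real s"] exI[of _ "- t / of_real s"]) (simp add: linear_root_def)
qed

lemma atiyah_lifts_exist: "\<exists>\<alpha> \<beta>. atiyah_lifts x \<alpha> \<beta>"
proof -
  have "\<forall>i j. \<exists>a b. (cmod a)\<^sup>2 + (cmod b)\<^sup>2 = 1 \<and> linear_root a b (stereo (direction x i j))"
    using unit_linear_root_exists by blast
  then show ?thesis unfolding atiyah_lifts_def by metis
qed

lemma linear_root_antipode:
  assumes u: "norm u = 1" and ab: "(cmod a)\<^sup>2 + (cmod b)\<^sup>2 = 1"
    and root: "linear_root a b (stereo u)"
  shows "linear_root (- cnj b) (cnj a) (stereo (- u))"
proof -
  define p q w where "p = vec_nth u 1" and "q = vec_nth u 2" and "w = vec_nth u 3"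
  have sph: "p\<^sup>2 + q\<^sup>2 + w\<^sup>2 = 1"
    using u by (simp add: norm_vec_def L2_set_def sum_3 p_def q_def w_def)
  show ?thesis
  proof (cases "w = 1")
    case True
    then have "p = 0" "q = 0" using sph by (auto simp: sum_power2_eq_zero_iff)
    then show ?thesis using True root
      by (simp add: linear_root_def stereo_def Complex_eq_0 flip: p_def q_def w_def)
  next
    case w1: False
    have ba: "b = - a * Complex p q / of_real (1 - w)"
      using root w1 by (simp add: linear_root_def stereo_def add_eq_0_iff2 flip: p_def q_def w_def)
    show ?thesis
    proof (cases "w = - 1")
      case True
      then have "p = 0" "q = 0" using sph by (auto simp: sum_power2_eq_zero_iff)
      then have "b = 0" using ba by (simp add: complex_eq_iff)
      then show ?thesis using True
        by (simp add: linear_root_def stereo_def flip: p_def q_def w_def)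
    next
      case w2: False
      have nz: "complex_of_real (1 - w) \<noteq> 0" "complex_of_real (1 + w) \<noteq> 0"
        using w1 w2 by (simp_all only: of_real_eq_0_iff)
      have "Complex p (- q) * Complex p q = of_real (p\<^sup>2 + q\<^sup>2)"
        by (simp add: complex_eq_iff power2_eq_square)
      also have "p\<^sup>2 + q\<^sup>2 = (1 - w) * (1 + w)"
        using sph by (simp add: algebra_simps power2_eq_square)
      finally have eq: "Complex p (- q) * Complex p q = of_real (1 - w) * of_real (1 + w)"
        by simp
      have cb: "cnj b = - cnj a * Complex p (- q) / of_real (1 - w)"
        unfolding ba by (simp add: complex_cnj)
      have "- cnj b * (- Complex p q / of_real (1 + w)) + cnj a
          = cnj a * (1 - (Complex p (- q) * Complex p q) / (of_real (1 - w) * of_real (1 + w)))"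
        unfolding cb by (simp add: algebra_simps)
      also have "\<dots> = 0" unfolding eq using nz by simp
      finally have "- cnj b * (- Complex p q / of_real (1 + w)) + cnj a = 0" .
      moreover have "- Complex p q = Complex (- p) (- q)" by (simp add: complex_eq_iff)
      ultimately show ?thesis using w2
        by (simp add: linear_root_def stereo_def flip: p_def q_def w_def)
    qed
  qed
qed

end

(* The chord from x_i to x_j of a circle points in the direction of angle (theta_i + theta_j)/2 + pi/2,
   so with z_i = exp (i theta_i/2) an SU(2) change of basis of the linear forms turns the root of
   l_ij into z_i z_j for i < j and into - z_i z_j for i > j. The determinant of the resulting monic
   cubics is 64 (z_1 z_2 z_3 z_4)^3 F with F = 1 + (1/2) sum_l S_l C_l real; here S_l is the product
   of the sines of the half-angles of the triangle opposite to the vertex l, and C_l is the sum of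
   cos^2 of half the three angles at l. Since d3 + 8abc = 8abc (1 + S_l) for that triangle, C3 becomes
   F^2 >= prod_l (1 + S_l). This follows from C_l >= 1 + 2 S_l, which in terms of the cosines of the
   arcs just says that a cosine lies in [-1,1], together with 0 <= S_l <= 1/2; as S_l >= 0, F >= 1
   gives C2. *)
theory Submission
  imports Defs
begin

section \<open>Determinants of products of linear forms\<close>

text \<open>Laplace expansion along the first row. The minors are again of the form
  \<open>mat n n\<close>, so that unfolding can iterate the rule.\<close>

lemma det_mat_Suc:
  fixes f :: "nat \<times> nat \<Rightarrow> 'a :: comm_ring_1"
  shows "det (mat (Suc n) (Suc n) f) =
    (\<Sum>j<Suc n. f (0, j) * ((-1) ^ j *
       det (mat n n (\<lambda>(r, c). f (Suc r, if c < j then c else Suc c)))))"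
proof -
  have "det (mat (Suc n) (Suc n) f) =
      (\<Sum>j<Suc n. mat (Suc n) (Suc n) f $$ (0, j) * cofactor (mat (Suc n) (Suc n) f) 0 j)"
    by (rule laplace_expansion_row[where n = "Suc n"]) auto
  also have "\<dots> = (\<Sum>j<Suc n. f (0, j) * ((-1) ^ j *
       det (mat n n (\<lambda>(r, c). f (Suc r, if c < j then c else Suc c)))))"
  proof (rule sum.cong[OF refl])
    fix j assume "j \<in> {..<Suc n}"
    then have j: "j < Suc n" by simp
    have "mat_delete (mat (Suc n) (Suc n) f) 0 j =
        mat n n (\<lambda>(r, c). f (Suc r, if c < j then c else Suc c))"
      by (rule eq_matI) (auto simp: mat_delete_def)
    then show "mat (Suc n) (Suc n) f $$ (0, j) * cofactor (mat (Suc n) (Suc n) f) 0 j =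
        f (0, j) * ((-1) ^ j * det (mat n n (\<lambda>(r, c). f (Suc r, if c < j then c else Suc c))))"
      using j by (simp add: cofactor_def)
  qed
  finally show ?thesis .
qed

text \<open>Grouped as 2x2 minors of the first two rows times the complementary minors of the last
  two, which keeps the formula compact.\<close>

lemma det_mat_4:
  fixes f :: "nat \<times> nat \<Rightarrow> 'a :: comm_ring_1"
  shows "det (mat 4 4 f) =
      (f (0,0) * f (1,1) - f (0,1) * f (1,0)) * (f (2,2) * f (3,3) - f (2,3) * f (3,2))
    - (f (0,0) * f (1,2) - f (0,2) * f (1,0)) * (f (2,1) * f (3,3) - f (2,3) * f (3,1))
    + (f (0,0) * f (1,3) - f (0,3) * f (1,0)) * (f (2,1) * f (3,2) - f (2,2) * f (3,1))
    + (f (0,1) * f (1,2) - f (0,2) * f (1,1)) * (f (2,0) * f (3,3) - f (2,3) * f (3,0))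
    - (f (0,1) * f (1,3) - f (0,3) * f (1,1)) * (f (2,0) * f (3,2) - f (2,2) * f (3,0))
    + (f (0,2) * f (1,3) - f (0,3) * f (1,2)) * (f (2,0) * f (3,1) - f (2,1) * f (3,0))"
proof -
  have 4: "(4::nat) = Suc (Suc (Suc (Suc 0)))" by simp
  show ?thesis
    unfolding 4 det_mat_Suc
    by (simp add: numeral_2_eq_2 numeral_3_eq_3 algebra_simps)
qed

text \<open>The elementary symmetric polynomials in three variables, with \<open>k\<close> from 0 to
  3 as the degree.\<close>

definition esym :: "('a :: comm_ring_1) \<Rightarrow> 'a \<Rightarrow> 'a \<Rightarrow> nat \<Rightarrow> 'a" where
  "esym x y z k = [1, x + y + z, x * y + x * z + y * z, x * y * z] ! k"

text \<open>The matrix is the third symmetric power of the base change with rows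
  \<open>(b, a)\<close> and \<open>(b', a')\<close>, up to binomial bookkeeping that leaves the
  determinant as the sixth power.\<close>

lemma det_binary_cubics:
  fixes a b :: "'a :: comm_ring_1"
  shows "det (mat 4 4 (\<lambda>(k, j). coeff ([:b, a:] ^ (3 - k) * [:b', a':] ^ k) j)) = (b * a' - a * b') ^ 6"
  unfolding det_mat_4
  by (simp add: numeral_3_eq_3 numeral_2_eq_2) (simp add: algebra_simps eval_nat_numeral)

(* After division by z_i z_j z_k, the two long factors of each term are multiples of S_l and C_l. *)
lemma det_cyclic:
  fixes z1 z2 z3 z4 :: complex
  shows "det (mat 4 4 (\<lambda>(i, k).
     [esym (z1 * z2) (z1 * z3) (z1 * z4) k,
      esym (- z2 * z1) (z2 * z3) (z2 * z4) k,
      esym (- z3 * z1) (- z3 * z2) (z3 * z4) k,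
      esym (- z4 * z1) (- z4 * z2) (- z4 * z3) k] ! i)) =
    64 * (z1 * z2 * z3 * z4) ^ 3 +
    z1^3 * (z2 * z3 * z4) *
      (z4*(z2^2+z3^2) + z2*(z3^2+z4^2) - z3*(z2^2+z4^2) - 2*z2*z3*z4) *
      (z4*(z2^2+z3^2) + z2*(z3^2+z4^2) + z3*(z2^2+z4^2) + 6*z2*z3*z4) +
    z2^3 * (z1 * z3 * z4) *
      (z4*(z1^2+z3^2) + z1*(z3^2+z4^2) - z3*(z1^2+z4^2) - 2*z1*z3*z4) *
      (- z4*(z1^2+z3^2) + z1*(z3^2+z4^2) - z3*(z1^2+z4^2) + 6*z1*z3*z4) +
    z3^3 * (z1 * z2 * z4) *
      (z4*(z1^2+z2^2) + z1*(z2^2+z4^2) - z2*(z1^2+z4^2) - 2*z1*z2*z4) *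
      (z4*(z1^2+z2^2) - z1*(z2^2+z4^2) - z2*(z1^2+z4^2) + 6*z1*z2*z4) +
    z4^3 * (z1 * z2 * z3) *
      (z3*(z1^2+z2^2) + z1*(z2^2+z3^2) - z2*(z1^2+z3^2) - 2*z1*z2*z3) *
      (z3*(z1^2+z2^2) + z1*(z2^2+z3^2) + z2*(z1^2+z3^2) + 6*z1*z2*z3)"
  unfolding det_mat_4 esym_def
  by (simp add: numeral_3_eq_3 numeral_2_eq_2, simp only: ring_distribs)
    (simp add: algebra_simps eval_nat_numeral)

text \<open>For \<open>z_i\<close> on the unit circle the hypotheses hold with \<open>k_ij\<close>
  the cosine of the angle from \<open>z_i\<close> to \<open>z_j\<close>. Each long factor in
  \<open>det_cyclic\<close> is then a monomial times 8 S_l or 4 C_l.\<close>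

lemma det_cyclic_cosines:
  fixes z1 z2 z3 z4 k12 k13 k14 k23 k24 k34 :: complex
  assumes "z1\<^sup>2 + z2\<^sup>2 = 2 * k12 * z1 * z2" "z1\<^sup>2 + z3\<^sup>2 = 2 * k13 * z1 * z3"
    and "z1\<^sup>2 + z4\<^sup>2 = 2 * k14 * z1 * z4" "z2\<^sup>2 + z3\<^sup>2 = 2 * k23 * z2 * z3"
    and "z2\<^sup>2 + z4\<^sup>2 = 2 * k24 * z2 * z4" "z3\<^sup>2 + z4\<^sup>2 = 2 * k34 * z3 * z4"
  shows "det (mat 4 4 (\<lambda>(i, k).
     [esym (z1 * z2) (z1 * z3) (z1 * z4) k,
      esym (- z2 * z1) (z2 * z3) (z2 * z4) k,
      esym (- z3 * z1) (- z3 * z2) (z3 * z4) k,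
      esym (- z4 * z1) (- z4 * z2) (- z4 * z3) k] ! i)) =
    64 * (z1 * z2 * z3 * z4) ^ 3 * (1 +
     ((k23 + k34 - k24 - 1) / 4 * ((3 + k23 + k34 + k24) / 2) +
      (k13 + k34 - k14 - 1) / 4 * ((3 + k34 - k14 - k13) / 2) +
      (k12 + k24 - k14 - 1) / 4 * ((3 + k12 - k14 - k24) / 2) +
      (k12 + k23 - k13 - 1) / 4 * ((3 + k12 + k23 + k13) / 2)) / 2)"
proof -
  define w where "w = z1 * z2 * z3 * z4"
  have "z4 * (z2\<^sup>2 + z3\<^sup>2) + z2 * (z3\<^sup>2 + z4\<^sup>2) - z3 * (z2\<^sup>2 + z4\<^sup>2) - 2 * z2 * z3 * z4 = (z2 * z3 * z4) * (2 * (k23 + k34 - k24 - 1))"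
    and "z4 * (z2\<^sup>2 + z3\<^sup>2) + z2 * (z3\<^sup>2 + z4\<^sup>2) + z3 * (z2\<^sup>2 + z4\<^sup>2) + 6 * z2 * z3 * z4 = (z2 * z3 * z4) * (2 * (3 + k23 + k34 + k24))"
    unfolding assms by (simp_all add: algebra_simps)
  note N1 = this
  \<comment> \<open>The cube of one variable and three copies of the product of the other three make
    up \<open>w ^ 3\<close>.\<close>
  have T1: "z1 ^ 3 * (z2 * z3 * z4) * ((z2 * z3 * z4) * a) * ((z2 * z3 * z4) * b) = w ^ 3 * (a * b)" for a b
    by (simp add: w_def power_mult_distrib power3_eq_cube mult_ac)
  have "z4 * (z1\<^sup>2 + z3\<^sup>2) + z1 * (z3\<^sup>2 + z4\<^sup>2) - z3 * (z1\<^sup>2 + z4\<^sup>2) - 2 * z1 * z3 * z4 = (z1 * z3 * z4) * (2 * (k13 + k34 - k14 - 1))"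
    and "- z4 * (z1\<^sup>2 + z3\<^sup>2) + z1 * (z3\<^sup>2 + z4\<^sup>2) - z3 * (z1\<^sup>2 + z4\<^sup>2) + 6 * z1 * z3 * z4 = (z1 * z3 * z4) * (2 * (3 + k34 - k14 - k13))"
    unfolding assms by (simp_all add: algebra_simps)
  note N2 = this
  have T2: "z2 ^ 3 * (z1 * z3 * z4) * ((z1 * z3 * z4) * a) * ((z1 * z3 * z4) * b) = w ^ 3 * (a * b)" for a b
    by (simp add: w_def power_mult_distrib power3_eq_cube mult_ac)
  have "z4 * (z1\<^sup>2 + z2\<^sup>2) + z1 * (z2\<^sup>2 + z4\<^sup>2) - z2 * (z1\<^sup>2 + z4\<^sup>2) - 2 * z1 * z2 * z4 = (z1 * z2 * z4) * (2 * (k12 + k24 - k14 - 1))"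
    and "z4 * (z1\<^sup>2 + z2\<^sup>2) - z1 * (z2\<^sup>2 + z4\<^sup>2) - z2 * (z1\<^sup>2 + z4\<^sup>2) + 6 * z1 * z2 * z4 = (z1 * z2 * z4) * (2 * (3 + k12 - k14 - k24))"
    unfolding assms by (simp_all add: algebra_simps)
  note N3 = this
  have T3: "z3 ^ 3 * (z1 * z2 * z4) * ((z1 * z2 * z4) * a) * ((z1 * z2 * z4) * b) = w ^ 3 * (a * b)" for a b
    by (simp add: w_def power_mult_distrib power3_eq_cube mult_ac)
  have "z3 * (z1\<^sup>2 + z2\<^sup>2) + z1 * (z2\<^sup>2 + z3\<^sup>2) - z2 * (z1\<^sup>2 + z3\<^sup>2) - 2 * z1 * z2 * z3 = (z1 * z2 * z3) * (2 * (k12 + k23 - k13 - 1))"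
    and "z3 * (z1\<^sup>2 + z2\<^sup>2) + z1 * (z2\<^sup>2 + z3\<^sup>2) + z2 * (z1\<^sup>2 + z3\<^sup>2) + 6 * z1 * z2 * z3 = (z1 * z2 * z3) * (2 * (3 + k12 + k23 + k13))"
    unfolding assms by (simp_all add: algebra_simps)
  note N4 = this
  have T4: "z4 ^ 3 * (z1 * z2 * z3) * ((z1 * z2 * z3) * a) * ((z1 * z2 * z3) * b) = w ^ 3 * (a * b)" for a b
    by (simp add: w_def power_mult_distrib power3_eq_cube mult_ac)
  have collect: "64 * W + W * (2 * s1 * (2 * c1)) + W * (2 * s2 * (2 * c2)) + W * (2 * s3 * (2 * c3))
      + W * (2 * s4 * (2 * c4)) =
      64 * W * (1 + (s1 / 4 * (c1 / 2) + s2 / 4 * (c2 / 2) + s3 / 4 * (c3 / 2) + s4 / 4 * (c4 / 2)) / 2)"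
    for W s1 s2 s3 s4 c1 c2 c3 c4 :: complex
    by (simp add: field_simps)
  show ?thesis
    unfolding det_cyclic N1 N2 N3 N4 T1 T2 T3 T4 w_def[symmetric] by (rule collect)
qed

text \<open>Each factor is \<open>c (e + x f)\<close> with the same two linear polynomials
  \<open>e\<close> and \<open>f\<close>, so the product expands in the cubics
  \<open>e ^ (3 - k) * f ^ k\<close>. This turns the coefficient matrix into a matrix
  product.\<close>

lemma coeff_prod3_linear:
  fixes a0 b0 a1 b1 :: "'a :: comm_ring_1"
  shows "coeff ([:c1 * (b0 + x1 * b1), c1 * (a0 + x1 * a1):] *
      [:c2 * (b0 + x2 * b1), c2 * (a0 + x2 * a1):] *
      [:c3 * (b0 + x3 * b1), c3 * (a0 + x3 * a1):]) j =
    (\<Sum>k<4. c1 * c2 * c3 * esym x1 x2 x3 k * coeff ([:b0, a0:] ^ (3 - k) * [:b1, a1:] ^ k) j)"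
proof -
  define e f where "e = [:b0, a0:]" and "f = [:b1, a1:]"
  have lin: "[:c * (b0 + x * b1), c * (a0 + x * a1):] = Polynomial.smult c (e + Polynomial.smult x f)" for c x
    by (simp add: e_def f_def)
  have "Polynomial.smult c1 (e + Polynomial.smult x1 f) * Polynomial.smult c2 (e + Polynomial.smult x2 f) * Polynomial.smult c3 (e + Polynomial.smult x3 f) =
      Polynomial.smult (c1 * c2 * c3) (e ^ 3 + Polynomial.smult (x1 + x2 + x3) (e ^ 2 * f)
        + Polynomial.smult (x1 * x2 + x1 * x3 + x2 * x3) (e * f ^ 2) + Polynomial.smult (x1 * x2 * x3) (f ^ 3))"
    by (simp add: algebra_simps smult_add_left smult_add_right power2_eq_square power3_eq_cube)
  then show ?thesis
    unfolding lin e_def[symmetric] f_def[symmetric]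
    by (simp add: eval_nat_numeral esym_def algebra_simps)
qed

lemma det_scale_rows_4:
  fixes e :: "nat \<Rightarrow> nat \<Rightarrow> 'a :: comm_ring_1"
  shows "det (mat 4 4 (\<lambda>(i, k). C i * e i k)) = C 0 * C 1 * C 2 * C 3 * det (mat 4 4 (\<lambda>(i, k). e i k))"
  unfolding det_mat_4 by (simp add: algebra_simps)

section \<open>Half-angles of a triangle\<close>

text \<open>The product of the sines of the half-angles of a triangle with angles \<open>s\<close>,
  \<open>t\<close>, \<open>pi - s - t\<close>, by \<open>half_sines_eq\<close>. It is defined
  through cosines because this is the form in which the determinant delivers it.\<close>

definition half_sines :: "real \<Rightarrow> real \<Rightarrow> real" where
  "half_sines s t = (cos s + cos t - cos (s + t) - 1) / 4"

lemma half_sines_eq: "half_sines s t = sin (s / 2) * sin (t / 2) * cos ((s + t) / 2)"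
proof -
  define x y where "x = s / 2" and "y = t / 2"
  have s: "s = 2 * x" and t: "t = 2 * y" and st: "(s + t) / 2 = x + y"
    by (simp_all add: x_def y_def)
  have "sin x * sin y * cos (x + y) =
      (cos (x - y) * cos (x + y) - cos (x + y) * cos (x + y)) / 2"
    by (simp add: sin_times_sin left_diff_distrib)
  also have "\<dots> = half_sines s t"
    unfolding half_sines_def cos_times_cos s t by (simp add: diff_divide_distrib add_divide_distrib)
  finally show ?thesis unfolding st x_def y_def by simp
qed

lemma half_sines_nonneg:
  assumes "s > 0" "t > 0" "s + t < pi"
  shows "half_sines s t \<ge> 0"
  unfolding half_sines_eq
  using assms by (intro mult_nonneg_nonneg sin_ge_zero cos_ge_zero) auto

text \<open>Bounding the three cosines separately is crude (the sharp constant is 1/8), but suffices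
  for \<open>prod_le_square\<close>.\<close>

lemma half_sines_le: "half_sines s t \<le> 1 / 2"
proof -
  have "cos s \<le> 1" "cos t \<le> 1" "- 1 \<le> cos (s + t)" by simp_all
  then have "cos s + cos t - cos (s + t) - 1 \<le> 2" by linarith
  then show ?thesis by (simp add: half_sines_def)
qed

text \<open>By the law of sines, a triangle with angles \<open>s\<close>, \<open>pi - s - t\<close>,
  \<open>t\<close> and circumdiameter \<open>k\<close> has sides \<open>A\<close>, \<open>B\<close>,
  \<open>C\<close>. Sum-to-product formulas factor each bracket of \<open>d3\<close> into half-angle
  functions, which recombine by the double-angle formula.\<close>

lemma d3_chords:
  fixes k s t :: real
  defines "A \<equiv> k * sin s" and "B \<equiv> k * sin (s + t)" and "C \<equiv> k * sin t"
  shows "d3 A B C + 8 * A * B * C = 8 * A * B * C * (1 + half_sines s t)"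
proof -
  define x y where "x = s / 2" and "y = t / 2"
  have s: "s = 2 * x" and t: "t = 2 * y" and xy: "(s + t) / 2 = x + y" and st: "s + t = 2 * (x + y)"
    by (simp_all add: x_def y_def)
  have "d3 A B C = 8 * A * B * C * half_sines s t"
  proof -
    have st': "sin (s + t) = 2 * sin (x + y) * cos (x + y)"
      unfolding st sin_double ..
    have "sin s + sin t = 2 * sin (x + y) * cos (x - y)"
      unfolding s t sin_plus_sin by (simp add: add_divide_distrib diff_divide_distrib)
    moreover have "A + C - B = k * (sin s + sin t) - k * sin (s + t)"
      by (simp add: A_def B_def C_def algebra_simps)
    ultimately have "A + C - B = 2 * k * sin (x + y) * (cos (x - y) - cos (x + y))"
      unfolding st' by (simp add: algebra_simps)
    then have 1: "A + C - B = 4 * k * sin x * sin y * sin (x + y)"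
      by (simp add: cos_diff cos_add)
    have "sin t - sin s = 2 * sin (y - x) * cos (x + y)"
      unfolding s t sin_diff_sin by (simp add: add_divide_distrib diff_divide_distrib add.commute)
    moreover have "B + C - A = k * sin (s + t) + k * (sin t - sin s)"
      by (simp add: A_def B_def C_def algebra_simps)
    ultimately have "B + C - A = 2 * k * cos (x + y) * (sin (x + y) + sin (y - x))"
      unfolding st' by (simp add: algebra_simps)
    then have 2: "B + C - A = 4 * k * cos x * sin y * cos (x + y)"
      by (simp add: sin_add sin_diff)
    have "sin s - sin t = 2 * sin (x - y) * cos (x + y)"
      unfolding s t sin_diff_sin by (simp add: add_divide_distrib diff_divide_distrib)
    moreover have "A + B - C = k * sin (s + t) + k * (sin s - sin t)"
      by (simp add: A_def B_def C_def algebra_simps)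
    ultimately have "A + B - C = 2 * k * cos (x + y) * (sin (x + y) + sin (x - y))"
      unfolding st' by (simp add: algebra_simps)
    then have 3: "A + B - C = 4 * k * sin x * cos y * cos (x + y)"
      by (simp add: sin_add sin_diff)
    have "d3 A B C = (A + B - C) * (B + C - A) * (A + C - B)"
      by (simp add: d3_def algebra_simps)
    also have "\<dots> = 8 * A * B * C * half_sines s t"
      unfolding 1 2 3 unfolding half_sines_eq xy A_def B_def C_def
      unfolding st x_def[symmetric] y_def[symmetric] unfolding s t sin_double
      by (simp add: algebra_simps)
    finally show ?thesis .
  qed
  then show ?thesis by (simp add: algebra_simps)
qed

section \<open>The algebraic inequality behind C3\<close>

text \<open>The bounds on the \<open>c_l\<close> reduce the right side to
  \<open>(1 + e1 / 2 + p2)\<^sup>2\<close>. On the left, \<open>s_l \<le> 1/2\<close> absorbs the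
  cubic and quartic terms into one more \<open>e2\<close>, and \<open>e2\<close> is controlled by
  \<open>p2\<close>.\<close>

lemma prod_le_square:
  fixes s1 s2 s3 s4 c1 c2 c3 c4 :: real
  assumes s: "0 \<le> s1" "s1 \<le> 1/2" "0 \<le> s2" "s2 \<le> 1/2" "0 \<le> s3" "s3 \<le> 1/2" "0 \<le> s4" "s4 \<le> 1/2"
    and c: "1 + 2 * s1 \<le> c1" "1 + 2 * s2 \<le> c2" "1 + 2 * s3 \<le> c3" "1 + 2 * s4 \<le> c4"
  shows "(1 + s1) * (1 + s2) * (1 + s3) * (1 + s4)
    \<le> (1 + (s1 * c1 + s2 * c2 + s3 * c3 + s4 * c4) / 2)\<^sup>2"
proof -
  define e1 e2 p2 where "e1 = s1 + s2 + s3 + s4"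
    and "e2 = s1 * s2 + s1 * s3 + s1 * s4 + s2 * s3 + s2 * s4 + s3 * s4"
    and "p2 = s1\<^sup>2 + s2\<^sup>2 + s3\<^sup>2 + s4\<^sup>2"
  \<comment> \<open>Replace one factor by 1/2 in each of the three possible ways and
    average.\<close>
  have triple: "x * y * z \<le> (x * y + x * z + y * z) / 6"
    if "0 \<le> x" "x \<le> 1/2" "0 \<le> y" "y \<le> 1/2" "0 \<le> z" "z \<le> 1/2" for x y z :: real
    using mult_left_mono[of z "1/2" "x * y"] mult_left_mono[of y "1/2" "x * z"]
      mult_left_mono[of x "1/2" "y * z"] that by (simp add: algebra_simps)
  have e3: "s1 * s2 * s3 + s1 * s2 * s4 + s1 * s3 * s4 + s2 * s3 * s4 \<le> e2 / 3"
    using triple[of s1 s2 s3] triple[of s1 s2 s4] triple[of s1 s3 s4] triple[of s2 s3 s4] s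
    by (simp add: e2_def)
  have "s3 * s4 \<le> (1/2) * (1/2)" using s by (intro mult_mono) auto
  then have "s1 * s2 * (s3 * s4) \<le> s1 * s2 * (1/4)" using s by (intro mult_left_mono) auto
  moreover have "s1 * s2 \<le> e2" using s by (simp add: e2_def)
  ultimately have e4: "s1 * s2 * s3 * s4 \<le> e2 / 4" by (simp add: mult.assoc)
  \<comment> \<open>The squares of the six differences add up to
    \<open>3 * p2 - 2 * e2\<close>.\<close>
  have p2: "2 * e2 \<le> 3 * p2"
    using sum_squares_ge_zero[of "s1 - s2" "s1 - s3"] sum_squares_ge_zero[of "s1 - s4" "s2 - s3"]
      sum_squares_ge_zero[of "s2 - s4" "s3 - s4"]
    by (simp add: e2_def p2_def power2_eq_square algebra_simps)
  have nn: "0 \<le> e1" "0 \<le> e2" "0 \<le> p2" using s by (auto simp: e1_def e2_def p2_def)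
  have "(1 + s1) * (1 + s2) * (1 + s3) * (1 + s4) =
      1 + e1 + e2 + (s1 * s2 * s3 + s1 * s2 * s4 + s1 * s3 * s4 + s2 * s3 * s4) + s1 * s2 * s3 * s4"
    by (simp add: e1_def e2_def algebra_simps)
  also have "\<dots> \<le> 1 + e1 + 2 * e2" using e3 e4 nn by linarith
  \<comment> \<open>As \<open>e1\<^sup>2 / 4 = p2 / 4 + e2 / 2\<close>, this is exactly
    \<open>2 * e2 \<le> 3 * p2\<close>.\<close>
  also have "\<dots> \<le> 1 + e1 + 2 * p2 + e1\<^sup>2 / 4"
  proof -
    have "e1\<^sup>2 = p2 + 2 * e2"
      by (simp add: e1_def e2_def p2_def power2_eq_square algebra_simps)
    then show ?thesis using p2 nn by linarith
  qed
  also have "\<dots> \<le> (1 + e1 / 2 + p2)\<^sup>2"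
    using nn by (simp add: power2_eq_square algebra_simps)
  also have "\<dots> \<le> (1 + (s1 * c1 + s2 * c2 + s3 * c3 + s4 * c4) / 2)\<^sup>2"
  proof (rule power_mono)
    have "s1 * (1 + 2 * s1) \<le> s1 * c1" "s2 * (1 + 2 * s2) \<le> s2 * c2"
      "s3 * (1 + 2 * s3) \<le> s3 * c3" "s4 * (1 + 2 * s4) \<le> s4 * c4"
      using s c by (auto intro!: mult_left_mono)
    then show "1 + e1 / 2 + p2 \<le> 1 + (s1 * c1 + s2 * c2 + s3 * c3 + s4 * c4) / 2"
      unfolding e1_def p2_def power2_eq_square distrib_left mult.right_neutral by argo
  qed (use nn in simp)
  finally show ?thesis .
qed

lemma cis_squares_add: "(cis a)\<^sup>2 + (cis b)\<^sup>2 = 2 * of_real (cos (b - a)) * cis a * cis b"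
proof -
  have "(cis a)\<^sup>2 + (cis b)\<^sup>2 = (cis (a - b) + cis (b - a)) * (cis a * cis b)"
    by (simp add: distrib_right cis_mult power2_eq_square)
  also have "cis (a - b) + cis (b - a) = 2 * of_real (cos (b - a))"
    by (simp add: complex_eq_iff cos_diff sin_diff)
  finally show ?thesis by (simp add: mult.assoc)
qed

section \<open>Linear forms with roots on a great circle\<close>

lemma norm_vec3_eq_1:
  fixes n :: "real^3"
  shows "norm n = 1 \<longleftrightarrow> (vec_nth n 1)\<^sup>2 + (vec_nth n 2)\<^sup>2 + (vec_nth n 3)\<^sup>2 = 1"
  by (simp add: norm_vec_def L2_set_def sum_3)

text \<open>The inverse of stereographic projection as a Hopf map: these products do not change with
  the phase of \<open>(a, b)\<close>, so they depend on \<open>n\<close> alone, and no case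
  distinction at the pole is left for later.\<close>

lemma linear_root_hopf:
  assumes n: "norm n = 1" and ab: "(cmod a)\<^sup>2 + (cmod b)\<^sup>2 = 1"
    and root: "linear_root a b (stereo n)"
  shows "a * cnj a = of_real ((1 - vec_nth n 3) / 2)"
    and "b * cnj b = of_real ((1 + vec_nth n 3) / 2)"
    and "cnj a * b = - Complex (vec_nth n 1) (vec_nth n 2) / 2"
proof -
  define p q w where "p = vec_nth n 1" and "q = vec_nth n 2" and "w = vec_nth n 3"
  have sph: "p\<^sup>2 + q\<^sup>2 + w\<^sup>2 = 1"
    using n by (simp add: norm_vec3_eq_1 p_def q_def w_def)
  have "(cmod a)\<^sup>2 = (1 - w) / 2 \<and> (cmod b)\<^sup>2 = (1 + w) / 2 \<and> cnj a * b = - Complex p q / 2"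
  proof (cases "w = 1")
    case True
    then have "p = 0" "q = 0" using sph by (auto simp: sum_power2_eq_zero_iff)
    then show ?thesis using True root ab
      by (simp add: linear_root_def stereo_def Complex_eq_0 flip: p_def q_def w_def)
  next
    case False
    have b: "b = - a * Complex p q / of_real (1 - w)"
      using root False by (simp add: linear_root_def stereo_def add_eq_0_iff2 flip: p_def q_def w_def)
    have pq: "p\<^sup>2 + q\<^sup>2 = (1 - w) * (1 + w)"
      using sph by (simp add: algebra_simps power2_eq_square)
    have "(cmod b)\<^sup>2 = (cmod a)\<^sup>2 * (p\<^sup>2 + q\<^sup>2) / (1 - w)\<^sup>2"
      unfolding b norm_mult norm_divide norm_minus_cancel norm_of_real power_mult_distrib power_divide
      by (simp add: cmod_power2)
    also have "\<dots> = (cmod a)\<^sup>2 * (1 + w) / (1 - w)"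
      using False unfolding pq by (simp add: power2_eq_square)
    finally have b2: "(cmod b)\<^sup>2 = (cmod a)\<^sup>2 * (1 + w) / (1 - w)" .
    have a2: "(cmod a)\<^sup>2 = (1 - w) / 2"
      using ab False unfolding b2 by (simp add: field_simps)
    have "cnj a * b = - (a * cnj a) * Complex p q / of_real (1 - w)"
      unfolding b by simp
    also have "a * cnj a = of_real ((1 - w) / 2)"
      unfolding complex_norm_square[symmetric] a2 by simp
    also have "- of_real ((1 - w) / 2) * Complex p q / of_real (1 - w) = - Complex p q / 2"
    proof -
      have "complex_of_real (1 - w) \<noteq> 0" using False by (simp only: of_real_eq_0_iff)
      then show ?thesis unfolding of_real_divide by (simp del: of_real_diff)
    qed
    finally have "cnj a * b = - Complex p q / 2" .
    moreover have "(cmod b)\<^sup>2 = (1 + w) / 2" using ab a2 by (simp add: field_simps)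
    ultimately show ?thesis using a2 by blast
  qed
  then show "a * cnj a = of_real ((1 - vec_nth n 3) / 2)"
    and "b * cnj b = of_real ((1 + vec_nth n 3) / 2)"
    and "cnj a * b = - Complex (vec_nth n 1) (vec_nth n 2) / 2"
    unfolding complex_norm_square[symmetric] p_def q_def w_def by (simp_all only:)
qed

text \<open>The Gram determinant of \<open>g\<close>, \<open>u\<close>, \<open>v\<close> is the
  square of their triple product. The product is bilinear without conjugation, so a nonzero complex
  \<open>g\<close> can be isotropic.\<close>

lemma isotropic_gram:
  fixes g1 g2 g3 u1 u2 u3 v1 v2 v3 :: "'a :: comm_ring_1"
  assumes "g1\<^sup>2 + g2\<^sup>2 + g3\<^sup>2 = 0"
    and "u1\<^sup>2 + u2\<^sup>2 + u3\<^sup>2 = 1" "v1\<^sup>2 + v2\<^sup>2 + v3\<^sup>2 = 1" "u1 * v1 + u2 * v2 + u3 * v3 = 0"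
    and "g1 * (u2 * v3 - u3 * v2) + g2 * (u3 * v1 - u1 * v3) + g3 * (u1 * v2 - u2 * v1) = 0"
  shows "(g1 * u1 + g2 * u2 + g3 * u3)\<^sup>2 + (g1 * v1 + g2 * v2 + g3 * v3)\<^sup>2 = 0"
proof -
  have "(g1 * u1 + g2 * u2 + g3 * u3)\<^sup>2 * (v1\<^sup>2 + v2\<^sup>2 + v3\<^sup>2)
      - 2 * (g1 * u1 + g2 * u2 + g3 * u3) * (g1 * v1 + g2 * v2 + g3 * v3) * (u1 * v1 + u2 * v2 + u3 * v3)
      + (g1 * v1 + g2 * v2 + g3 * v3)\<^sup>2 * (u1\<^sup>2 + u2\<^sup>2 + u3\<^sup>2)
      + (g1 * (u2 * v3 - u3 * v2) + g2 * (u3 * v1 - u1 * v3) + g3 * (u1 * v2 - u2 * v1))\<^sup>2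
    = (g1\<^sup>2 + g2\<^sup>2 + g3\<^sup>2) * ((u1\<^sup>2 + u2\<^sup>2 + u3\<^sup>2) * (v1\<^sup>2 + v2\<^sup>2 + v3\<^sup>2)
      - (u1 * v1 + u2 * v2 + u3 * v3)\<^sup>2)"
    by (simp add: power2_eq_square algebra_simps)
  then show ?thesis unfolding assms by simp
qed

text \<open>Turn the normal \<open>w\<close> of the plane into a pole: the great circle becomes the
  equator, and its unit spinors have equally large coordinates with relative phase
  \<open>cis t\<close> in an orthonormal basis of spinors over \<open>w\<close> and
  \<open>- w\<close>. A unitary base change has determinant of modulus 1.\<close>

lemma planar_spinors:
  fixes u v :: "real^3"
  assumes u: "norm u = 1" and v: "norm v = 1" and uv: "u \<bullet> v = 0"
  obtains a0 b0 a1 b1 where "cmod (b0 * a1 - a0 * b1) = 1"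
    and "\<forall>t a b. (cmod a)\<^sup>2 + (cmod b)\<^sup>2 = 1 \<longrightarrow>
      linear_root a b (stereo (cos t *\<^sub>R u + sin t *\<^sub>R v)) \<longrightarrow>
      (\<exists>c. (cmod c)\<^sup>2 = 1 / 2 \<and> a = c * (a0 + cis t * a1) \<and> b = c * (b0 + cis t * b1))"
proof -
  define w where "w = cross3 u v"
  have w: "norm w = 1"
    using norm_cross_dot[of u v] u v uv
    by (simp add: w_def power2_eq_1_iff) (smt (verit) norm_ge_zero)
  have uw: "u \<bullet> w = 0" and vw: "v \<bullet> w = 0" by (simp_all add: w_def dot_cross_self)
  obtain p q where pq: "(cmod p)\<^sup>2 + (cmod q)\<^sup>2 = 1" and pqw: "linear_root p q (stereo w)"
    using unit_linear_root_exists by blast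
  note hw = linear_root_hopf[OF w pq pqw]
  (* For a unit lift c (p, q) + d (- cnj q, cnj p) of n, g n is d * cnj c. *)
  define g where "g n = p * q * of_real (vec_nth n 3)
      - p\<^sup>2 * Complex (vec_nth n 1) (vec_nth n 2) / 2
      + q\<^sup>2 * cnj (Complex (vec_nth n 1) (vec_nth n 2)) / 2" for n :: "real^3"
  have pq1: "p * cnj p + q * cnj q = 1"
    using pq unfolding complex_norm_square[symmetric] by (metis of_real_1 of_real_add)
  have lift: "\<exists>c. (cmod c)\<^sup>2 = 1 / 2 \<and> a = c * (p - 2 * g n * cnj q) \<and> b = c * (q + 2 * g n * cnj p)
      \<and> cmod (2 * g n) = 1"
    if n: "norm n = 1" and nw: "n \<bullet> w = 0" and ab: "(cmod a)\<^sup>2 + (cmod b)\<^sup>2 = 1"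
      and root: "linear_root a b (stereo n)" for n a b
  proof -
    note h = linear_root_hopf[OF n ab root]
    have h3': "a * cnj b = - cnj (Complex (vec_nth n 1) (vec_nth n 2)) / 2"
      using arg_cong[OF h(3), of cnj] by simp
    have hw3': "p * cnj q = - cnj (Complex (vec_nth w 1) (vec_nth w 2)) / 2"
      using arg_cong[OF hw(3), of cnj] by simp
    \<comment> \<open>The coordinates of \<open>(a, b)\<close> in the orthonormal basis
      \<open>(p, q)\<close>, \<open>(- cnj q, cnj p)\<close>.\<close>
    define c d where "c = cnj p * a + cnj q * b" and "d = p * b - q * a"
    have "c * cnj c = (p * cnj p) * (a * cnj a) + (q * cnj q) * (b * cnj b)
        + (p * cnj q) * (cnj a * b) + (cnj p * q) * (a * cnj b)"
      by (simp add: c_def algebra_simps)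
    also have "\<dots> = of_real ((1 + n \<bullet> w) / 2)"
      unfolding h hw h3' hw3'
      by (simp add: complex_eq_iff inner_vec_def sum_3 field_simps)
    finally have cc: "c * cnj c = 1 / 2" using nw by simp
    have c2: "(cmod c)\<^sup>2 = 1 / 2"
    proof -
      have "complex_of_real ((cmod c)\<^sup>2) = of_real (1 / 2)"
        unfolding complex_norm_square cc by simp
      then show ?thesis using of_real_eq_iff by blast
    qed
    have "d * cnj c = p * q * (b * cnj b - a * cnj a) + p\<^sup>2 * (cnj a * b) - q\<^sup>2 * (a * cnj b)"
      by (simp add: c_def d_def power2_eq_square algebra_simps)
    also have "\<dots> = g n"
      unfolding h h3' g_def by (simp add: field_simps)
    finally have dc: "d * cnj c = g n" .
    \<comment> \<open>\<open>n \<bullet> w = 0\<close> forced \<open>c * cnj c = 1 / 2\<close>, so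
      \<open>d\<close> is recovered from \<open>d * cnj c\<close>.\<close>
    have d: "d = 2 * g n * c"
    proof -
      have "2 * g n * c = 2 * d * (c * cnj c)" unfolding dc[symmetric] by simp
      then show ?thesis unfolding cc by simp
    qed
    have "c * p - d * cnj q = (p * cnj p + q * cnj q) * a"
      by (simp add: c_def d_def algebra_simps)
    then have a: "a = c * (p - 2 * g n * cnj q)" unfolding pq1 d by (simp add: algebra_simps)
    have "c * q + d * cnj p = (p * cnj p + q * cnj q) * b"
      by (simp add: c_def d_def algebra_simps)
    then have b: "b = c * (q + 2 * g n * cnj p)" unfolding pq1 d by (simp add: algebra_simps)
    have "c * cnj c + d * cnj d = (p * cnj p + q * cnj q) * (a * cnj a + b * cnj b)"
      by (simp add: c_def d_def algebra_simps)
    also have "\<dots> = 1" unfolding pq1 h by (simp add: field_simps)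
    finally have "d * cnj d = 1 - c * cnj c" by (simp add: algebra_simps)
    then have "d * cnj d = 1 / 2" unfolding cc by simp
    then have "complex_of_real ((cmod d)\<^sup>2) = of_real (1 / 2)"
      unfolding complex_norm_square by simp
    then have "(cmod d)\<^sup>2 = (cmod c)\<^sup>2" unfolding c2 using of_real_eq_iff by blast
    then have "cmod d = cmod c" by simp
    then have "cmod (2 * g n) * cmod c = 1 * cmod c" unfolding d by (simp add: norm_mult)
    moreover have "cmod c \<noteq> 0" using c2 by auto
    ultimately have "cmod (2 * g n) = 1" using mult_right_cancel by blast
    then show ?thesis using c2 a b by blast
  qed
  define m where "m = 2 * g u"
  have m: "cmod m = 1"
    using lift[OF u uw] unit_linear_root_exists[of "stereo u"] unfolding m_def by blast
  \<comment> \<open>Since \<open>w\<close> is the cross product of \<open>u\<close> and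
    \<open>v\<close>, this is the vanishing triple product required by
    \<open>isotropic_gram\<close>.\<close>
  have gw: "g w = 0"
  proof -
    have 1: "Complex (vec_nth w 1) (vec_nth w 2) = - 2 * (cnj p * q)"
      unfolding hw(3) by simp
    have 2: "complex_of_real (vec_nth w 3) = q * cnj q - p * cnj p"
      unfolding hw by (simp add: field_simps)
    show ?thesis unfolding g_def 1 2 by (simp add: power2_eq_square algebra_simps)
  qed
  have g_lin: "g n = ((q\<^sup>2 - p\<^sup>2) / 2) * of_real (vec_nth n 1)
      + (- \<i> * (p\<^sup>2 + q\<^sup>2) / 2) * of_real (vec_nth n 2) + p * q * of_real (vec_nth n 3)" for n
    unfolding g_def by (simp add: Complex_eq field_simps)
  have n: "norm (cos t *\<^sub>R u + sin t *\<^sub>R v) = 1" for t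
    using u v uv by (simp add: norm_eq_1 inner_add_left inner_add_right inner_commute
        power2_eq_square[symmetric])
  have nw: "(cos t *\<^sub>R u + sin t *\<^sub>R v) \<bullet> w = 0" for t
    by (simp add: inner_add_left uw vw)
  have g_plane: "g (cos t *\<^sub>R u + sin t *\<^sub>R v) = of_real (cos t) * g u + of_real (sin t) * g v" for t
    unfolding g_lin by (simp add: algebra_simps add_divide_distrib)
  have cis: "cis t = of_real (cos t) + \<i> * of_real (sin t)" for t
    by (simp add: complex_eq_iff)
  (* g n is the bilinear product of n with an isotropic vector of C^3 orthogonal to w, so g v = i g u
     or g v = - i g u; in the second case the roles of the two spinors are exchanged. *)
  have "(g u)\<^sup>2 + (g v)\<^sup>2 = 0"
    unfolding g_lin
  proof (rule isotropic_gram)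
    show "((q\<^sup>2 - p\<^sup>2) / 2)\<^sup>2 + (- \<i> * (p\<^sup>2 + q\<^sup>2) / 2)\<^sup>2 + (p * q)\<^sup>2 = 0"
      by (simp add: power2_eq_square field_simps)
    show "(complex_of_real (vec_nth u 1))\<^sup>2 + (of_real (vec_nth u 2))\<^sup>2 + (of_real (vec_nth u 3))\<^sup>2 = 1"
      using arg_cong[OF u[unfolded norm_vec3_eq_1], of complex_of_real] by simp
    show "(complex_of_real (vec_nth v 1))\<^sup>2 + (of_real (vec_nth v 2))\<^sup>2 + (of_real (vec_nth v 3))\<^sup>2 = 1"
      using arg_cong[OF v[unfolded norm_vec3_eq_1], of complex_of_real] by simp
    show "complex_of_real (vec_nth u 1) * of_real (vec_nth v 1) + of_real (vec_nth u 2) * of_real (vec_nth v 2)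
        + of_real (vec_nth u 3) * of_real (vec_nth v 3) = 0"
      using arg_cong[OF uv[unfolded inner_vec_def sum_3], of complex_of_real] by simp
  qed (use gw in \<open>simp add: g_lin w_def cross3_def\<close>)
  then have "(g v - \<i> * g u) * (g v + \<i> * g u) = 0"
    by (simp add: power2_eq_square algebra_simps)
  then consider "g v = \<i> * g u" | "g v = - \<i> * g u"
    by (auto simp: add_eq_0_iff2)
  then show ?thesis
  proof cases
    case 1
    \<comment> \<open>The instantiation follows the order of occurrence \<open>b0\<close>,
      \<open>a1\<close>, \<open>a0\<close>, \<open>b1\<close>.\<close>
    show ?thesis
    proof (rule that[of q "- m * cnj q" p "m * cnj p"]; (intro allI impI)?)
      have "q * (- m * cnj q) - p * (m * cnj p) = - m * (p * cnj p + q * cnj q)"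
        by (simp add: algebra_simps)
      then show "cmod (q * (- m * cnj q) - p * (m * cnj p)) = 1" using m pq1 by simp
    next
      fix t a b
      assume ab: "(cmod a)\<^sup>2 + (cmod b)\<^sup>2 = 1"
        and root: "linear_root a b (stereo (cos t *\<^sub>R u + sin t *\<^sub>R v))"
      have *: "2 * g (cos t *\<^sub>R u + sin t *\<^sub>R v) = cis t * m"
        unfolding g_plane 1 m_def cis by (simp add: algebra_simps)
      show "\<exists>c. (cmod c)\<^sup>2 = 1 / 2 \<and> a = c * (p + cis t * (- m * cnj q)) \<and> b = c * (q + cis t * (m * cnj p))"
        using lift[OF n nw ab root] unfolding * by (auto simp: mult.assoc)
    qed
  next
    case 2
    show ?thesis
    proof (rule that[of "m * cnj p" p "- m * cnj q" q]; (intro allI impI)?)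
      have "m * cnj p * p - - m * cnj q * q = m * (p * cnj p + q * cnj q)"
        by (simp add: algebra_simps)
      then show "cmod (m * cnj p * p - - m * cnj q * q) = 1" using m pq1 by simp
    next
      fix t a b
      assume ab: "(cmod a)\<^sup>2 + (cmod b)\<^sup>2 = 1"
        and root: "linear_root a b (stereo (cos t *\<^sub>R u + sin t *\<^sub>R v))"
      have *: "2 * g (cos t *\<^sub>R u + sin t *\<^sub>R v) = cis (- t) * m"
        unfolding g_plane 2 m_def cis by (simp add: algebra_simps)
      obtain c where c: "(cmod c)\<^sup>2 = 1 / 2" "a = c * (p - cis (- t) * m * cnj q)"
          "b = c * (q + cis (- t) * m * cnj p)"
        using lift[OF n nw ab root] unfolding * by blast
      \<comment> \<open>Moving \<open>cis (- t)\<close> into the scalar shifts the phase from one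
        spinor to the other.\<close>
      have t: "cis (- t) * cis t = 1" by (simp add: cis_mult)
      have "c * (p - cis (- t) * m * cnj q) = c * (cis (- t) * cis t * p - cis (- t) * m * cnj q)"
        by (simp only: t mult_1_left)
      then have "c * (p - cis (- t) * m * cnj q) = c * cis (- t) * (- m * cnj q + cis t * p)"
        by (simp add: algebra_simps)
      moreover have "c * (q + cis (- t) * m * cnj p) =
          c * (cis (- t) * cis t * q + cis (- t) * m * cnj p)"
        by (simp only: t mult_1_left)
      then have "c * (q + cis (- t) * m * cnj p) = c * cis (- t) * (m * cnj p + cis t * q)"
        by (simp add: algebra_simps)
      ultimately show "\<exists>c. (cmod c)\<^sup>2 = 1 / 2 \<and> a = c * (- m * cnj q + cis t * p) \<and> b = c * (m * cnj p + cis t * q)"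
        using c by (intro exI[of _ "c * cis (- t)"]) (simp add: norm_mult)
    qed
  qed
qed

text \<open>In the basis of \<open>planar_spinors\<close> every form is
  \<open>K_ij (e + \<zeta>_ij f)\<close>, so the coefficient matrix is a diagonal matrix times the
  matrix of symmetric functions times a base change with determinant of modulus 1. The diagonal part
  contributes 1/64.\<close>

lemma cmod_atiyah_det:
  fixes u v :: "real^3" and x :: "nat \<Rightarrow> real^3"
  assumes uv: "norm u = 1" "norm v = 1" "u \<bullet> v = 0"
    and lifts: "atiyah_lifts x \<alpha> \<beta>"
    and dir: "\<And>i j. i \<in> {1..4} \<Longrightarrow> j \<in> {1..4} \<Longrightarrow> i < j \<Longrightarrow>
      direction x i j = cos (\<tau> i + \<tau> j) *\<^sub>R u + sin (\<tau> i + \<tau> j) *\<^sub>R v"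
  defines "z \<equiv> (\<lambda>i. cis (\<tau> i))"
  shows "cmod (det (mat 4 4 (\<lambda>(i, j). coeff (atiyah_poly \<alpha> \<beta> (i + 1)) j))) =
    cmod (det (mat 4 4 (\<lambda>(i, k).
     [esym (z 1 * z 2) (z 1 * z 3) (z 1 * z 4) k,
      esym (- z 2 * z 1) (z 2 * z 3) (z 2 * z 4) k,
      esym (- z 3 * z 1) (- z 3 * z 2) (z 3 * z 4) k,
      esym (- z 4 * z 1) (- z 4 * z 2) (- z 4 * z 3) k] ! i))) / 64"
proof -
  obtain a0 b0 a1 b1 where D: "cmod (b0 * a1 - a0 * b1) = 1"
    and spin: "\<forall>t a b. (cmod a)\<^sup>2 + (cmod b)\<^sup>2 = 1 \<longrightarrow>
      linear_root a b (stereo (cos t *\<^sub>R u + sin t *\<^sub>R v)) \<longrightarrow>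
      (\<exists>c. (cmod c)\<^sup>2 = 1 / 2 \<and> a = c * (a0 + cis t * a1) \<and> b = c * (b0 + cis t * b1))"
    by (rule planar_spinors[OF uv])
  \<comment> \<open>For \<open>i > j\<close> the direction is the antipode, that is, the angle grows
    by \<open>pi\<close>, whence the sign.\<close>
  define \<zeta> where "\<zeta> i j = (if i < j then z i * z j else - z i * z j)" for i j
  have "\<exists>c. (cmod c)\<^sup>2 = 1 / 2 \<and>
      atiyah_ell \<alpha> \<beta> i j = [:c * (b0 + \<zeta> i j * b1), c * (a0 + \<zeta> i j * a1):]"
    if ij: "i \<in> {1..4}" "j \<in> {1..4}" "i \<noteq> j" for i j
  proof (cases "i < j")
    case True
    have "(cmod (\<alpha> i j))\<^sup>2 + (cmod (\<beta> i j))\<^sup>2 = 1"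
      and "linear_root (\<alpha> i j) (\<beta> i j) (stereo (direction x i j))"
      using lifts ij True unfolding atiyah_lifts_def by blast+
    from spin[rule_format, OF this[unfolded dir[OF ij(1,2) True]]] show ?thesis
      using True by (auto simp: atiyah_ell_def \<zeta>_def z_def cis_mult)
  next
    case False
    then have ji: "j < i" using ij by simp
    have unit: "(cmod (\<alpha> j i))\<^sup>2 + (cmod (\<beta> j i))\<^sup>2 = 1"
      and root: "linear_root (\<alpha> j i) (\<beta> j i) (stereo (direction x j i))"
      using lifts ij ji unfolding atiyah_lifts_def by blast+
    define t where "t = \<tau> j + \<tau> i"
    have d: "direction x j i = cos t *\<^sub>R u + sin t *\<^sub>R v"
      unfolding dir[OF ij(2,1) ji] t_def ..
    have n: "norm (cos t *\<^sub>R u + sin t *\<^sub>R v) = 1"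
      using uv by (simp add: norm_eq_1 inner_add_left inner_add_right inner_commute
          power2_eq_square[symmetric])
    have eq: "- (cos t *\<^sub>R u + sin t *\<^sub>R v) = cos (t + pi) *\<^sub>R u + sin (t + pi) *\<^sub>R v"
      by simp
    have "linear_root (- cnj (\<beta> j i)) (cnj (\<alpha> j i)) (stereo (cos (t + pi) *\<^sub>R u + sin (t + pi) *\<^sub>R v))"
      using linear_root_antipode[OF n unit root[unfolded d]] unfolding eq .
    moreover have "(cmod (- cnj (\<beta> j i)))\<^sup>2 + (cmod (cnj (\<alpha> j i)))\<^sup>2 = 1"
      using unit by simp
    ultimately obtain c where c: "(cmod c)\<^sup>2 = 1 / 2"
      "- cnj (\<beta> j i) = c * (a0 + cis (t + pi) * a1)" "cnj (\<alpha> j i) = c * (b0 + cis (t + pi) * b1)"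
      using spin by blast
    have "cis (t + pi) = \<zeta> i j"
      using False by (simp add: \<zeta>_def z_def cis_mult t_def cis_pi mult.commute flip: cis_mult)
    then show ?thesis using False c by (auto simp: atiyah_ell_def)
  qed
  then obtain K where K: "\<And>i j. i \<in> {1..4} \<Longrightarrow> j \<in> {1..4} \<Longrightarrow> i \<noteq> j \<Longrightarrow> (cmod (K i j))\<^sup>2 = 1 / 2 \<and>
      atiyah_ell \<alpha> \<beta> i j = [:K i j * (b0 + \<zeta> i j * b1), K i j * (a0 + \<zeta> i j * a1):]"
    by metis
  define C where "C = (\<lambda>i. [K 1 2 * K 1 3 * K 1 4, K 2 1 * K 2 3 * K 2 4,
    K 3 1 * K 3 2 * K 3 4, K 4 1 * K 4 2 * K 4 3] ! i)"
  define e where "e = (\<lambda>i k. [esym (z 1 * z 2) (z 1 * z 3) (z 1 * z 4) k,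
      esym (- z 2 * z 1) (z 2 * z 3) (z 2 * z 4) k,
      esym (- z 3 * z 1) (- z 3 * z 2) (z 3 * z 4) k,
      esym (- z 4 * z 1) (- z 4 * z 2) (- z 4 * z 3) k] ! i)"
  have row: "coeff (atiyah_poly \<alpha> \<beta> (i + 1)) j =
      (\<Sum>k<4. C i * e i k * coeff ([:b0, a0:] ^ (3 - k) * [:b1, a1:] ^ k) j)" if i: "i < 4" for i j
  proof -
    have poly3: "atiyah_poly \<alpha> \<beta> l = atiyah_ell \<alpha> \<beta> l p * atiyah_ell \<alpha> \<beta> l q * atiyah_ell \<alpha> \<beta> l r"
      if "{1..4} - {l} = {p, q, r}" "p < q" "q < r" for l p q r
      using that by (simp add: atiyah_poly_def mult.assoc)
    have coeff3: "coeff (atiyah_poly \<alpha> \<beta> l) j = (\<Sum>k<4. K l p * K l q * K l r *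
        esym (\<zeta> l p) (\<zeta> l q) (\<zeta> l r) k * coeff ([:b0, a0:] ^ (3 - k) * [:b1, a1:] ^ k) j)"
      if l: "l \<in> {1..4}" and pqr: "{1..4} - {l} = {p, q, r}" "p < q" "q < r" for l p q r
    proof -
      have "p \<in> {1..4} - {l}" "q \<in> {1..4} - {l}" "r \<in> {1..4} - {l}" unfolding pqr by auto
      then show ?thesis
        using K[OF l, of p] K[OF l, of q] K[OF l, of r] unfolding poly3[OF pqr]
        by (simp add: coeff_prod3_linear del: mult_pCons_left mult_pCons_right)
    qed
    have others: "{1..4} - {1} = {2, 3, 4::nat}" "{1..4} - {2} = {1, 3, 4::nat}"
        "{1..4} - {3} = {1, 2, 4::nat}" "{1..4} - {4} = {1, 2, 3::nat}"
      by auto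
    consider "i = 0" | "i = 1" | "i = 2" | "i = 3" using i by linarith
    then show ?thesis
    proof cases
      case 1 then show ?thesis using coeff3[OF _ others(1)] by (simp add: C_def e_def \<zeta>_def)
    next
      case 2 then show ?thesis using coeff3[OF _ others(2)]
        by (simp add: C_def e_def \<zeta>_def flip: numeral_2_eq_2)
    next
      case 3 then show ?thesis using coeff3[OF _ others(3)] by (simp add: C_def e_def \<zeta>_def)
    next
      case 4 then show ?thesis using coeff3[OF _ others(4)] by (simp add: C_def e_def \<zeta>_def)
    qed
  qed
  \<comment> \<open>The base change from monomials to the cubics in the two spinors.\<close>
  define B where "B = mat 4 4 (\<lambda>(k, j). coeff ([:b0, a0:] ^ (3 - k) * [:b1, a1:] ^ k) j)"
  have "mat 4 4 (\<lambda>(i, j). coeff (atiyah_poly \<alpha> \<beta> (i + 1)) j) = mat 4 4 (\<lambda>(i, k). C i * e i k) * B"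
    by (rule eq_matI) (simp_all add: row B_def scalar_prod_def lessThan_atLeast0 del: One_nat_def)
  then have "det (mat 4 4 (\<lambda>(i, j). coeff (atiyah_poly \<alpha> \<beta> (i + 1)) j)) =
      C 0 * C 1 * C 2 * C 3 * det (mat 4 4 (\<lambda>(i, k). e i k)) * (b0 * a1 - a0 * b1) ^ 6"
    by (simp add: det_mult[where n = 4] B_def det_scale_rows_4 det_binary_cubics)
  moreover have "cmod (C 0 * C 1 * C 2 * C 3) = 1 / 64"
  proof -
    \<comment> \<open>Twelve factors \<open>K i j\<close>, each with squared modulus 1/2.\<close>
    have "(cmod (C 0 * C 1 * C 2 * C 3))\<^sup>2 = (1 / 64)\<^sup>2"
      by (simp add: C_def norm_mult power_mult_distrib power_divide K)
    then show ?thesis by (simp add: power2_eq_iff_nonneg)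
  qed
  ultimately show ?thesis using D by (simp add: norm_mult norm_power e_def)
qed

section \<open>Cyclic quadrilaterals\<close>

text \<open>Sum-to-product formulas write \<open>y - x\<close> as a multiple of the unit tangent at
  the mean angle; the multiple is positive since \<open>(b - a) / 2\<close> lies between 0 and
  \<open>pi\<close>.\<close>

lemma circle_chord:
  fixes c u v :: "'a :: real_inner"
  assumes uv: "norm u = 1" "norm v = 1" "u \<bullet> v = 0" and R: "R > 0" and ab: "a < b" "b < a + 2 * pi"
  defines "x \<equiv> c + R *\<^sub>R (cos a *\<^sub>R u + sin a *\<^sub>R v)" and "y \<equiv> c + R *\<^sub>R (cos b *\<^sub>R u + sin b *\<^sub>R v)"
  shows "dist x y = 2 * R * sin ((b - a) / 2)"
    and "(y - x) /\<^sub>R dist x y = cos ((a + b) / 2) *\<^sub>R v + sin ((a + b) / 2) *\<^sub>R (- u)"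
proof -
  define n where "n = cos ((a + b) / 2) *\<^sub>R v + sin ((a + b) / 2) *\<^sub>R (- u)"
  have s: "sin ((b - a) / 2) > 0" using ab by (intro sin_gt_zero) auto
  have "y - x = R *\<^sub>R ((cos b - cos a) *\<^sub>R u + (sin b - sin a) *\<^sub>R v)"
    by (simp add: x_def y_def algebra_simps)
  also have "cos b - cos a = - (2 * sin ((b - a) / 2) * sin ((a + b) / 2))"
    using cos_diff_cos[of a b] by (simp add: algebra_simps)
  also have "sin b - sin a = 2 * sin ((b - a) / 2) * cos ((a + b) / 2)"
    using sin_diff_sin[of b a] by (simp add: add.commute)
  finally have yx: "y - x = (2 * R * sin ((b - a) / 2)) *\<^sub>R n"
    by (simp add: n_def algebra_simps)
  have n: "norm n = 1"
    using uv by (simp add: n_def norm_eq_1 inner_diff_left inner_diff_right inner_commute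
        power2_eq_square[symmetric])
  show d: "dist x y = 2 * R * sin ((b - a) / 2)"
  proof -
    have "dist x y = norm (y - x)" by (simp add: dist_norm norm_minus_commute)
    then show ?thesis unfolding yx using n s R by simp
  qed
  show "(y - x) /\<^sub>R dist x y = n"
  proof -
    have nz: "2 * R * sin ((b - a) / 2) \<noteq> 0" using s R by simp
    show ?thesis unfolding d yx scaleR_scaleR left_inverse[OF nz] scaleR_one ..
  qed
qed

theorem mainTheorem2:
  fixes x :: "nat \<Rightarrow> real^3" and \<alpha> \<beta> :: "nat \<Rightarrow> nat \<Rightarrow> complex"
  assumes "inj_on x {1..4}"
    and "cyclic_quadrilateral x"
    and "atiyah_lifts x \<alpha> \<beta>"
  shows "(cmod (atiyah_D4 x \<alpha> \<beta>))\<^sup>2 \<ge>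
      (\<Prod>i\<in>{1..4}. \<Prod>j\<in>{i<..4}. \<Prod>k\<in>{j<..4}.
         d3 (rdist x i j) (rdist x i k) (rdist x j k) + 8 * rdist x i j * rdist x i k * rdist x j k)
    \<and> cmod (atiyah_D4 x \<alpha> \<beta>) \<ge> 64 * (\<Prod>i\<in>{1..4}. \<Prod>j\<in>{i<..4}. rdist x i j)"
proof -
  obtain c u v :: "real^3" and R \<theta> where u: "norm u = 1" and v: "norm v = 1" and uv: "u \<bullet> v = 0" and R: "R > 0"
    and \<theta>: "\<theta> 1 < \<theta> 2" "\<theta> 2 < \<theta> 3" "\<theta> 3 < \<theta> 4" "\<theta> 4 < \<theta> 1 + 2 * pi"
    and x: "\<forall>i\<in>{1..4}. x i = c + R *\<^sub>R (cos (\<theta> i) *\<^sub>R u + sin (\<theta> i) *\<^sub>R v)"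
    using assms(2) unfolding cyclic_quadrilateral_def by blast
  have \<theta>_less: "\<theta> i < \<theta> j" "\<theta> j < \<theta> i + 2 * pi"
    if "i \<in> {1..4}" "j \<in> {1..4}" "i < j" for i j :: nat
  proof -
    have "i \<in> {1, 2, 3, 4}" "j \<in> {1, 2, 3, 4}" using that by auto
    then show "\<theta> i < \<theta> j" "\<theta> j < \<theta> i + 2 * pi" using that(3) \<theta> by auto
  qed
  \<comment> \<open>With half-angles, \<open>\<tau> j - \<tau> i\<close> is an inscribed angle over
    the chord, and \<open>\<tau> i + \<tau> j\<close> the angle of its direction.\<close>
  define \<tau> where "\<tau> i = \<theta> i / 2" for i
  have chord: "rdist x i j = 2 * R * sin (\<tau> j - \<tau> i)"
      "direction x i j = cos (\<tau> i + \<tau> j) *\<^sub>R v + sin (\<tau> i + \<tau> j) *\<^sub>R (- u)"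
    if ij: "i \<in> {1..4}" "j \<in> {1..4}" "i < j" for i j
    using circle_chord[OF u v uv R \<theta>_less[OF ij], of c] x ij
    unfolding direction_def rdist_def \<tau>_def by (auto simp: diff_divide_distrib add_divide_distrib)
  define r where "r = (\<lambda>i j. rdist x i j)"
  have r_pos: "r i j > 0" if ij: "i \<in> {1..4}" "j \<in> {1..4}" "i < j" for i j
    unfolding r_def chord(1)[OF ij] \<tau>_def using R \<theta>_less[OF ij]
    by (intro mult_pos_pos sin_gt_zero) (auto simp: field_simps)
  \<comment> \<open>S_l for the triangle \<open>i\<close>, \<open>j\<close>, \<open>k\<close>, whose
    third angle is \<open>pi - (\<tau> k - \<tau> i)\<close>.\<close>
  define h where "h i j k = half_sines (\<tau> j - \<tau> i) (\<tau> k - \<tau> j)" for i j k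
  have h: "0 \<le> h i j k" "h i j k \<le> 1 / 2"
    "d3 (r i j) (r i k) (r j k) + 8 * r i j * r i k * r j k = 8 * r i j * r i k * r j k * (1 + h i j k)"
    if "i \<in> {1..4}" "j \<in> {1..4}" "k \<in> {1..4}" "i < j" "j < k" for i j k
  proof -
    show "0 \<le> h i j k"
      unfolding h_def \<tau>_def
      using \<theta>_less[of i j] \<theta>_less[of j k] \<theta>_less[of i k] that
      by (intro half_sines_nonneg) auto
    show "h i j k \<le> 1 / 2" unfolding h_def by (rule half_sines_le)
    show "d3 (r i j) (r i k) (r j k) + 8 * r i j * r i k * r j k =
        8 * r i j * r i k * r j k * (1 + h i j k)"
      using d3_chords[of "2 * R" "\<tau> j - \<tau> i" "\<tau> k - \<tau> j"] that
      by (simp add: r_def chord h_def)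
  qed
  define \<kappa> where "\<kappa> i j = cos (\<tau> j - \<tau> i)" for i j
  have h_cos: "h i j k = (\<kappa> i j + \<kappa> j k - \<kappa> i k - 1) / 4" for i j k
    by (simp add: h_def half_sines_def \<kappa>_def)
  \<comment> \<open>C_l from the angles at vertex \<open>l\<close>. A minus sign marks an angle such
    as \<open>pi - (\<tau> 3 - \<tau> 1)\<close> at vertex 2.\<close>
  define C1 C2 C3 C4 where "C1 = (3 + \<kappa> 2 3 + \<kappa> 3 4 + \<kappa> 2 4) / 2"
    and "C2 = (3 + \<kappa> 3 4 - \<kappa> 1 4 - \<kappa> 1 3) / 2"
    and "C3 = (3 + \<kappa> 1 2 - \<kappa> 1 4 - \<kappa> 2 4) / 2"
    and "C4 = (3 + \<kappa> 1 2 + \<kappa> 2 3 + \<kappa> 1 3) / 2"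
  define F where "F = 1 + (h 2 3 4 * C1 + h 1 3 4 * C2 + h 1 2 4 * C3 + h 1 2 3 * C4) / 2"
  have "- 1 \<le> \<kappa> i j" "\<kappa> i j \<le> 1" for i j by (simp_all add: \<kappa>_def)
  note \<kappa> = this
  \<comment> \<open>The four differences are \<open>1 + \<kappa> 2 4\<close>,
    \<open>1 - \<kappa> 1 3\<close>, \<open>1 - \<kappa> 2 4\<close> and
    \<open>1 + \<kappa> 1 3\<close>.\<close>
  have C: "1 + 2 * h 2 3 4 \<le> C1" "1 + 2 * h 1 3 4 \<le> C2" "1 + 2 * h 1 2 4 \<le> C3" "1 + 2 * h 1 2 3 \<le> C4"
    using \<kappa>(1)[of 2 4] \<kappa>(2)[of 1 3] \<kappa>(2)[of 2 4] \<kappa>(1)[of 1 3]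
    unfolding h_cos C1_def C2_def C3_def C4_def by argo+
  have hs: "0 \<le> h 2 3 4" "h 2 3 4 \<le> 1 / 2" "0 \<le> h 1 3 4" "h 1 3 4 \<le> 1 / 2"
      "0 \<le> h 1 2 4" "h 1 2 4 \<le> 1 / 2" "0 \<le> h 1 2 3" "h 1 2 3 \<le> 1 / 2"
    by (rule h(1,2); simp)+
  have F2: "(1 + h 2 3 4) * (1 + h 1 3 4) * (1 + h 1 2 4) * (1 + h 1 2 3) \<le> F\<^sup>2"
    unfolding F_def by (rule prod_le_square[OF hs C])
  have "0 \<le> h 2 3 4 * C1" "0 \<le> h 1 3 4 * C2" "0 \<le> h 1 2 4 * C3" "0 \<le> h 1 2 3 * C4"
    using hs C by (auto intro!: mult_nonneg_nonneg)
  then have F1: "1 \<le> F" by (simp add: F_def)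
  define P where "P = r 1 2 * r 1 3 * r 1 4 * r 2 3 * r 2 4 * r 3 4"
  have P: "P > 0" unfolding P_def by (intro mult_pos_pos r_pos) auto
  have upto: "{1..4} = {1, 2, 3, 4::nat}" "{1<..4} = {2, 3, 4::nat}" "{2<..4} = {3, 4::nat}"
      "{3<..4} = {4::nat}"
    by auto
  have pairs: "(\<Prod>i\<in>{1..4}. \<Prod>j\<in>{i<..4}. rdist x i j) = P"
    by (simp add: upto P_def r_def del: One_nat_def)
  have D: "cmod (atiyah_D4 x \<alpha> \<beta>) = 64 * P * F"
  proof -
    \<comment> \<open>The chord directions are expressed in the orthonormal pair \<open>v\<close>,
      \<open>- u\<close>.\<close>
    have vu: "norm (- u) = 1" "v \<bullet> - u = 0" using u uv by (simp_all add: inner_commute)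
    have sq: "(cis (\<tau> i))\<^sup>2 + (cis (\<tau> j))\<^sup>2 = 2 * of_real (\<kappa> i j) * cis (\<tau> i) * cis (\<tau> j)" for i j
      unfolding \<kappa>_def by (rule cis_squares_add)
    have "cmod (det (mat 4 4 (\<lambda>(i, j). coeff (atiyah_poly \<alpha> \<beta> (i + 1)) j))) =
       cmod (64 * (cis (\<tau> 1) * cis (\<tau> 2) * cis (\<tau> 3) * cis (\<tau> 4)) ^ 3 * of_real F) / 64"
      using cmod_atiyah_det[where \<tau> = \<tau>, OF v vu assms(3) chord(2)]
      unfolding det_cyclic_cosines[OF sq sq sq sq sq sq]
      by (simp add: F_def h_cos C1_def C2_def C3_def C4_def)
    also have "\<dots> = F" using F1 by (simp add: norm_mult norm_power)
    finally show ?thesis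
      using P unfolding atiyah_D4_def pairs by (simp add: norm_mult)
  qed
  have "(\<Prod>i\<in>{1..4}. \<Prod>j\<in>{i<..4}. \<Prod>k\<in>{j<..4}.
         d3 (rdist x i j) (rdist x i k) (rdist x j k) + 8 * rdist x i j * rdist x i k * rdist x j k)
    = (\<Prod>i\<in>{1..4}. \<Prod>j\<in>{i<..4}. \<Prod>k\<in>{j<..4}. 8 * r i j * r i k * r j k * (1 + h i j k))"
    unfolding r_def[symmetric] by (intro prod.cong refl h(3)) auto
  \<comment> \<open>Every side belongs to two of the four triangles, and
    \<open>8 ^ 4 = 64\<^sup>2\<close>.\<close>
  also have "\<dots> = (64 * P)\<^sup>2 * ((1 + h 2 3 4) * (1 + h 1 3 4) * (1 + h 1 2 4) * (1 + h 1 2 3))"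
    by (simp add: upto P_def power2_eq_square mult_ac
        del: One_nat_def distrib_left_numeral distrib_right_numeral)
  also have "\<dots> \<le> (64 * P)\<^sup>2 * F\<^sup>2" by (intro mult_left_mono F2) simp
  finally show ?thesis
    unfolding D pairs using F1 P by (simp add: power_mult_distrib)
qed

end
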